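(* Let $n\geq 1$ be an integer and let $\varepsilon\in\{+1,-1\}$. Let $K$ be the Klein bottle obtained from the rectangle $[0,\frac{\pi}{2n}]\times[0,\pi]$ by the boundary identifications $(\varphi,0)\sim(\varphi,\pi)$ for $\varphi\in[0,\frac{\pi}{2n}]$ and $(0,\theta)\sim(\frac{\pi}{2n},\pi-\theta)$ for $\theta\in[0,\pi]$. Then the map $$\iota\colon \Bigl[0,\frac{\pi}{2n}\Bigr]\times[0,\pi]\longrightarrow S^3,\qquad (\varphi,\theta)\longmapsto\bigl(\sin\theta\, e^{i\varphi},\ \cos\theta\, e^{\varepsilon i\varphi}\bigr),$$ descends to an embedding of $K$ into the lens space $L(4n,2n+\varepsilon)$.
   Context: $S^3$ is the unit sphere in $\mathbb{C}^2$. For coprime integers $p\geq 1$ and $q$, the lens space $L(p,q)$ is the quotient of $S^3$ by the free $\mathbb{Z}_p$-action generated by $\sigma(z_1,z_2)=(e^{2\pi i/p}z_1,\,e^{2\pi i q/p}z_2)$. "Descends" means that the composition of $\iota$ with the quotient projection $S^3\to L(4n,2n+\varepsilon)$ factors through $K$. *)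

theory Defs
  imports "HOL-Analysis.Analysis"
begin

definition quotient_topology :: "'a topology \<Rightarrow> ('a \<times> 'a) set \<Rightarrow> 'a set topology" where
  "quotient_topology X r = topology (\<lambda>U. U \<subseteq> topspace X // r \<and> openin X (\<Union>U))"

lemma openin_quotient_topology:
  assumes "equiv (topspace X) r"
  shows "openin (quotient_topology X r) U \<longleftrightarrow> U \<subseteq> topspace X // r \<and> openin X (\<Union>U)"
proof -
  have int: "\<Union>(S \<inter> T) = \<Union>S \<inter> \<Union>T"
    if "S \<subseteq> topspace X // r" "T \<subseteq> topspace X // r" for S T
  proof
    show "\<Union>S \<inter> \<Union>T \<subseteq> \<Union>(S \<inter> T)"
    proof
      fix x assume "x \<in> \<Union>S \<inter> \<Union>T"
      then obtain A B where "A \<in> S" "B \<in> T" "x \<in> A" "x \<in> B" by blast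
      moreover from this that have "A = B"
        using quotient_disj[OF assms, of A B] by blast
      ultimately show "x \<in> \<Union>(S \<inter> T)" by blast
    qed
  qed blast
  have "istopology (\<lambda>U. U \<subseteq> topspace X // r \<and> openin X (\<Union>U))"
    unfolding istopology_def
  proof (intro conjI allI impI)
    fix S T
    assume S: "S \<subseteq> topspace X // r \<and> openin X (\<Union>S)"
      and T: "T \<subseteq> topspace X // r \<and> openin X (\<Union>T)"
    show "S \<inter> T \<subseteq> topspace X // r" using S by blast
    show "openin X (\<Union>(S \<inter> T))" using S T int[of S T] by auto
  next
    fix F assume F: "\<forall>S\<in>F. S \<subseteq> topspace X // r \<and> openin X (\<Union>S)"
    show "\<Union>F \<subseteq> topspace X // r" using F by blast
    have "\<Union>(\<Union>F) = \<Union>(Union ` F)" by blast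
    then show "openin X (\<Union>(\<Union>F))" using F by auto
  qed
  then show ?thesis
    by (simp add: quotient_topology_def topology_inverse')
qed

lemma topspace_quotient_topology:
  assumes "equiv (topspace X) r"
  shows "topspace (quotient_topology X r) = topspace X // r"
proof -
  have "openin (quotient_topology X r) (topspace X // r)"
    by (simp add: openin_quotient_topology[OF assms] Union_quotient[OF assms])
  then show ?thesis
    using openin_quotient_topology[OF assms] openin_subset openin_topspace by blast
qed

lemma quotient_map_class:
  assumes "equiv (topspace X) r"
  shows "quotient_map X (quotient_topology X r) (\<lambda>x. r `` {x})"
proof -
  have *: "{x \<in> topspace X. r `` {x} \<in> U} = \<Union>U" if "U \<subseteq> topspace X // r" for U
  proof (intro set_eqI iffI)
    fix x assume "x \<in> {x \<in> topspace X. r `` {x} \<in> U}"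
    then have "x \<in> r `` {x}" "r `` {x} \<in> U"
      using equiv_class_self[OF assms] by simp_all
    then show "x \<in> \<Union>U" by (rule UnionI[rotated])
  next
    fix x assume "x \<in> \<Union>U"
    then obtain A where A: "A \<in> U" "x \<in> A" by blast
    then have "A \<in> topspace X // r" using that by blast
    then obtain y where y: "y \<in> topspace X" "A = r `` {y}" by (rule quotientE)
    with A(2) have "(y, x) \<in> r" by simp
    then have "x \<in> topspace X" "r `` {y} = r `` {x}"
      using equiv_class_eq_iff[OF assms, of y x] by simp_all
    then have "x \<in> topspace X" "r `` {x} = A" by (simp_all add: y)
    then show "x \<in> {x \<in> topspace X. r `` {x} \<in> U}" using A by simp
  qed
  have "(\<lambda>x. r `` {x}) ` topspace X = topspace X // r"
    by (auto simp: quotient_def)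
  then show ?thesis
    unfolding quotient_map_def topspace_quotient_topology[OF assms]
    by (simp add: openin_quotient_topology[OF assms] *)
qed

definition klein_rect :: "int \<Rightarrow> (real \<times> real) set" where
  "klein_rect n = {0..pi / (2 * of_int n)} \<times> {0..pi}"

inductive klein_glue :: "int \<Rightarrow> real \<times> real \<Rightarrow> real \<times> real \<Rightarrow> bool" for n where
  "\<phi> \<in> {0..pi / (2 * of_int n)} \<Longrightarrow> klein_glue n (\<phi>, 0) (\<phi>, pi)"
| "\<theta> \<in> {0..pi} \<Longrightarrow> klein_glue n (0, \<theta>) (pi / (2 * of_int n), pi - \<theta>)"

definition klein_rel :: "int \<Rightarrow> ((real \<times> real) \<times> (real \<times> real)) set" where
  "klein_rel n = {(x, y). x \<in> klein_rect n \<and> y \<in> klein_rect n \<and> equivclp (klein_glue n) x y}"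

definition klein_bottle :: "int \<Rightarrow> (real \<times> real) set topology" where
  "klein_bottle n = quotient_topology (top_of_set (klein_rect n)) (klein_rel n)"

lemma equiv_klein_rel: "equiv (klein_rect n) (klein_rel n)"
proof (rule equivI)
  show "klein_rel n \<subseteq> klein_rect n \<times> klein_rect n" by (auto simp: klein_rel_def)
  show "refl_on (klein_rect n) (klein_rel n)" by (rule refl_onI) (simp add: klein_rel_def)
  show "sym (klein_rel n)" by (rule symI) (simp add: klein_rel_def equivclp_sym)
  show "trans (klein_rel n)"
    by (rule transI) (simp only: klein_rel_def mem_Collect_eq prod.case, blast intro: equivclp_trans)
qed

abbreviation S3 :: "(complex \<times> complex) set" where
  "S3 \<equiv> sphere 0 1"

definition lens_gen :: "int \<Rightarrow> int \<Rightarrow> complex \<times> complex \<Rightarrow> complex \<times> complex" where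
  "lens_gen p q = (\<lambda>(z1, z2). (cis (2 * pi / of_int p) * z1, cis (2 * pi * of_int q / of_int p) * z2))"

text \<open>Since \<open>\<sigma> = lens_gen p q\<close> has finite order, its nonnegative iterates already
  give all elements of the cyclic group that it generates.\<close>

definition lens_rel :: "int \<Rightarrow> int \<Rightarrow> ((complex \<times> complex) \<times> (complex \<times> complex)) set" where
  "lens_rel p q = {(x, y). x \<in> S3 \<and> y \<in> S3 \<and> (\<exists>k::nat. y = (lens_gen p q ^^ k) x)}"

definition lens_space :: "int \<Rightarrow> int \<Rightarrow> (complex \<times> complex) set topology" where
  "lens_space p q = quotient_topology (top_of_set S3) (lens_rel p q)"

lemma lens_gen_funpow:
  "(lens_gen p q ^^ k) (z1, z2) =
     (cis (of_nat k * (2 * pi / of_int p)) * z1, cis (of_nat k * (2 * pi * of_int q / of_int p)) * z2)"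
proof (induction k)
  case (Suc k)
  have "cis (real (Suc k) * t) = cis t * cis (real k * t)" for t
    by (simp add: cis_mult distrib_right)
  moreover have "(lens_gen p q ^^ Suc k) (z1, z2) = lens_gen p q ((lens_gen p q ^^ k) (z1, z2))"
    by simp
  ultimately show ?case
    by (simp only: Suc) (simp only: lens_gen_def prod.case mult.assoc)
qed simp

lemma lens_gen_order:
  assumes "p \<ge> 1"
  shows "lens_gen p q ^^ nat p = id"
proof -
  have "cis (real_of_int p * (2 * pi * of_int m / of_int p)) = 1" for m
    using assms cis_multiple_2pi[of "of_int m"] by (simp add: mult.commute)
  from this[of 1] this[of q] show ?thesis
    using assms by (auto simp: fun_eq_iff lens_gen_funpow)
qed

lemma equiv_lens_rel:
  assumes "p \<ge> 1"
  shows "equiv S3 (lens_rel p q)"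
proof (rule equivI)
  let ?s = "lens_gen p q"
  show "lens_rel p q \<subseteq> S3 \<times> S3" by (auto simp: lens_rel_def)
  show "refl_on S3 (lens_rel p q)"
  proof (rule refl_onI)
    fix x assume "x \<in> S3"
    moreover have "x = (?s ^^ 0) x" by simp
    ultimately show "(x, x) \<in> lens_rel p q" unfolding lens_rel_def by blast
  qed
  show "trans (lens_rel p q)"
  proof (rule transI)
    fix x y z assume "(x, y) \<in> lens_rel p q" "(y, z) \<in> lens_rel p q"
    then obtain k l where "x \<in> S3" "z \<in> S3" "y = (?s ^^ k) x" "z = (?s ^^ l) y"
      by (auto simp: lens_rel_def)
    then have "z = (?s ^^ (l + k)) x" by (simp only: funpow_add comp_apply)
    with \<open>x \<in> S3\<close> \<open>z \<in> S3\<close> show "(x, z) \<in> lens_rel p q"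
      unfolding lens_rel_def by blast
  qed
  show "sym (lens_rel p q)"
  proof (rule symI)
    fix x y assume "(x, y) \<in> lens_rel p q"
    then obtain k where k: "x \<in> S3" "y \<in> S3" "y = (?s ^^ k) x" by (auto simp: lens_rel_def)
    have "(?s ^^ (nat p * k)) x = x"
      by (simp add: funpow_mult[symmetric] lens_gen_order[OF assms])
    moreover have "nat p * k = (nat p * k - k) + k"
      using assms by (cases "nat p") auto
    ultimately have "(?s ^^ (nat p * k - k)) y = x"
      unfolding k by (metis comp_apply funpow_add)
    then show "(y, x) \<in> lens_rel p q"
      using k unfolding lens_rel_def by blast
  qed
qed

lemma coprime_lens_parameters:
  fixes n \<epsilon> :: int
  assumes "\<epsilon> \<in> {1, -1}"
  shows "coprime (4 * n) (2 * n + \<epsilon>)"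
proof (rule coprimeI)
  fix d assume d: "d dvd 4 * n" "d dvd 2 * n + \<epsilon>"
  have "(2 * n + \<epsilon>) * (2 * n + \<epsilon>) - (n + \<epsilon>) * (4 * n) = 1"
    using assms by (auto simp: algebra_simps)
  then show "is_unit d"
    using dvd_diff[OF dvd_mult[OF d(2)] dvd_mult[OF d(1)]] by metis
qed

definition klein_map :: "int \<Rightarrow> real \<times> real \<Rightarrow> complex \<times> complex" where
  "klein_map \<epsilon> = (\<lambda>(\<phi>, \<theta>). (of_real (sin \<theta>) * cis \<phi>, of_real (cos \<theta>) * cis (of_int \<epsilon> * \<phi>)))"

lemma klein_map_in_S3: "klein_map \<epsilon> x \<in> S3"
  by (cases x) (simp add: klein_map_def norm_Pair norm_mult)

end

theory Submission
  imports Defs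
begin

text \<open>Put \<open>\<alpha> = pi / (2 n)\<close>. The generator of the deck group acts by
  \<open>(z\<^sub>1, z\<^sub>2) \<mapsto> (e\<^bsup>i\<alpha>\<^esup> z\<^sub>1, -e\<^bsup>\<epsilon>i\<alpha>\<^esup> z\<^sub>2)\<close>, so it carries \<open>\<iota>(0, \<theta>)\<close> to \<open>\<iota>(\<alpha>, pi - \<theta>)\<close>, and its power \<open>2 n\<close>
  carries \<open>\<iota>(\<phi>, 0)\<close> to \<open>\<iota>(\<phi>, pi)\<close>. Conversely, if the \<open>k\<close>-th power identifies two points in the
  image of \<open>\<iota>\<close>, then their angles \<open>\<phi>\<close> in \<open>[0, \<alpha>]\<close> differ by a multiple of \<open>\<alpha>\<close>, so they agree or are
  the two endpoints. Where \<open>sin \<theta> \<noteq> 0\<close> the difference is \<open>k \<alpha>\<close> modulo \<open>2 pi = 4 n \<alpha>\<close>, so the parity of \<open>k\<close>,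
  which is the relative sign of \<open>cos \<theta>\<close>, tells these two cases apart. So the lens space
  relation pulls back exactly to the Klein bottle relation. The orbit map of a finite group
  action is closed, hence so is the induced injection.\<close>

section \<open>Embeddings of quotient spaces\<close>

text \<open>Equal fibres make \<open>h\<close> factor through \<open>q\<close> by an injective
  continuous \<open>g\<close>. For closed \<open>C\<close> in \<open>Y\<close>, the image of
  \<open>C\<close> under \<open>g\<close> is the image under \<open>h\<close> of the closed preimage
  of \<open>C\<close>, so \<open>g\<close> is closed.\<close>

lemma embedding_map_from_quotient:
  assumes q: "quotient_map X Y q" and cont: "continuous_map X Z h" and closed: "closed_map X Z h"
    and fibres: "\<And>x y. x \<in> topspace X \<Longrightarrow> y \<in> topspace X \<Longrightarrow> q x = q y \<longleftrightarrow> h x = h y"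
  obtains g where "embedding_map Y Z g" "\<And>x. x \<in> topspace X \<Longrightarrow> g (q x) = h x"
proof -
  obtain g where g: "continuous_map Y Z g" "\<And>x. x \<in> topspace X \<Longrightarrow> g (q x) = h x"
    using quotient_map_lift_exists[OF q cont] fibres by metis
  have surj: "q ` topspace X = topspace Y"
    using q by (rule quotient_imp_surjective_map)
  have "closed_map X Z (g \<circ> q)"
    using closed_map_eq[OF closed, of "g \<circ> q"] g(2) by simp
  then have "closed_map Y Z g"
    by (rule closed_map_from_composition_left[OF _ quotient_imp_continuous_map[OF q] surj])
  moreover have "inj_on g (topspace Y)"
    using fibres g(2) unfolding surj[symmetric] by (auto simp: inj_on_def)
  ultimately show thesis
    using that injective_closed_imp_embedding_map g by blast
qed

lemma cis_eq_cis_iff: "cis y = cis x \<longleftrightarrow> (\<exists>m::int. y = x + 2 * pi * m)"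
  using sin_cos_eq_iff[of y x] by (auto simp: complex_eq_iff)

section \<open>Closedness of the lens space projection\<close>

lemma continuous_on_lens_gen_funpow: "continuous_on A (lens_gen p q ^^ k)"
proof (induction k)
  case (Suc k)
  have "continuous_on B (lens_gen p q)" for B
    unfolding lens_gen_def case_prod_unfold by (intro continuous_intros)
  with Suc show ?case
    by (simp only: funpow.simps continuous_on_compose)
qed (simp add: continuous_on_id id_def)

lemma lens_gen_funpow_in_S3: "x \<in> S3 \<Longrightarrow> (lens_gen p q ^^ k) x \<in> S3"
  by (cases x) (simp add: lens_gen_funpow norm_Pair norm_mult)

text \<open>An image in the quotient is closed iff its saturation is. The saturation of
  \<open>C\<close> is a finite union of translates of \<open>C\<close>, each compact because the
  sphere is.\<close>

lemma closed_map_lens_projection: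
  assumes "p \<ge> 1"
  shows "closed_map (top_of_set S3) (lens_space p q) (\<lambda>x. lens_rel p q `` {x})"
  unfolding closed_map_def
proof (intro allI impI)
  let ?r = "lens_rel p q"
  let ?s = "lens_gen p q"
  fix C assume "closedin (top_of_set S3) C"
  then have C: "C \<subseteq> S3" "compact C"
    using closedin_compact[OF compact_sphere] closedin_subset by fastforce+
  have eq: "equiv (topspace (top_of_set S3)) ?r"
    using equiv_lens_rel[OF assms] by simp
  have quot: "quotient_map (top_of_set S3) (lens_space p q) (\<lambda>x. ?r `` {x})"
    unfolding lens_space_def by (rule quotient_map_class[OF eq])
  have img: "(\<lambda>x. ?r `` {x}) ` C \<subseteq> topspace (lens_space p q)"
    using C quotient_imp_surjective_map[OF quot] by auto
  \<comment> \<open>Exponents reduce modulo the order of the generator; this makes the union of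
    translates finite.\<close>
  have red: "(?s ^^ k) x = (?s ^^ (k mod nat p)) x" for k x
    using funpow_mod_eq[of "nat p" ?s x k] lens_gen_order[OF assms, of q] by simp
  have cls: "?r `` {x} = ?r `` {c} \<longleftrightarrow> (c, x) \<in> ?r" if "x \<in> S3" "c \<in> C" for x c
    by (subst eq_commute, rule eq_equiv_class_iff[OF equiv_lens_rel[OF assms] subsetD[OF C(1)]])
      (fact that)+
  have "{x \<in> S3. ?r `` {x} \<in> (\<lambda>x. ?r `` {x}) ` C} = {x \<in> S3. \<exists>c\<in>C. (c, x) \<in> ?r}"
    by (intro Collect_cong conj_cong refl) (simp add: image_iff cls cong: bex_cong)
  also have "\<dots> = (\<Union>k<nat p. (?s ^^ k) ` C)"
  proof (intro equalityI subsetI)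
    fix x assume "x \<in> {x \<in> S3. \<exists>c\<in>C. (c, x) \<in> ?r}"
    then obtain c k where "c \<in> C" "x = (?s ^^ k) c" by (auto simp: lens_rel_def)
    then have "x = (?s ^^ (k mod nat p)) c" "k mod nat p < nat p"
      using red[of k c] assms by simp_all
    with \<open>c \<in> C\<close> show "x \<in> (\<Union>k<nat p. (?s ^^ k) ` C)" by blast
  next
    fix x assume "x \<in> (\<Union>k<nat p. (?s ^^ k) ` C)"
    then obtain c k where c: "c \<in> C" "x = (?s ^^ k) c" by blast
    have "c \<in> S3"
      using C(1) c(1) by (rule subsetD)
    then have "x \<in> S3"
      unfolding c(2) by (rule lens_gen_funpow_in_S3)
    with c(2) \<open>c \<in> S3\<close> have "(c, x) \<in> ?r"
      unfolding lens_rel_def by (simp only: mem_Collect_eq prod.case) iprover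
    with c(1) \<open>x \<in> S3\<close> show "x \<in> {x \<in> S3. \<exists>c\<in>C. (c, x) \<in> ?r}"
      by (intro CollectI conjI bexI)
  qed
  finally have sat: "{x \<in> S3. ?r `` {x} \<in> (\<lambda>x. ?r `` {x}) ` C} = (\<Union>k<nat p. (?s ^^ k) ` C)" .
  have "compact {x \<in> S3. ?r `` {x} \<in> (\<lambda>x. ?r `` {x}) ` C}"
    unfolding sat using C(2) by (intro compact_UN compact_continuous_image continuous_on_lens_gen_funpow) auto
  then have "closedin (top_of_set S3) {x \<in> S3. ?r `` {x} \<in> (\<lambda>x. ?r `` {x}) ` C}"
    by (intro closed_subset compact_imp_closed) (rule Collect_restrict)
  then show "closedin (lens_space p q) ((\<lambda>x. ?r `` {x}) ` C)"
    using quot img unfolding quotient_map_closedin by simp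
qed

section \<open>The deck group acting on the image of the rectangle\<close>

lemma continuous_on_klein_map: "continuous_on A (klein_map \<epsilon>)"
  unfolding klein_map_def case_prod_unfold by (intro continuous_intros)

lemma cis_sign_mult: "\<epsilon> \<in> {1, -1 :: int} \<Longrightarrow> cis (of_int \<epsilon> * pi) = -1"
  by (auto simp: complex_eq_iff)

text \<open>With p = 4n and q = 2n + \<epsilon>, the angle 2 pi q/p is a half turn plus \<epsilon>
  times pi/(2n). The half turn yields the sign \<open>(-1) ^ k\<close>; the rest shifts \<phi> by
  the same amount in both coordinates.\<close>

lemma lens_gen_klein_funpow:
  assumes "n \<ge> 1" and e: "\<epsilon> \<in> {1, -1}"
  shows "(lens_gen (4 * n) (2 * n + \<epsilon>) ^^ k) (z1, z2) =
    (cis (of_nat k * (pi / (2 * of_int n))) * z1,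
     (-1) ^ k * cis (of_int \<epsilon> * (of_nat k * (pi / (2 * of_int n)))) * z2)"
proof -
  have a: "2 * pi * of_int (2 * n + \<epsilon>) / of_int (4 * n) = pi + of_int \<epsilon> * (pi / (2 * of_int n))"
    "2 * pi / of_int (4 * n) = pi / (2 * of_int n)"
    using assms(1) by (simp_all add: field_simps)
  have "cis (of_nat k * (pi + of_int \<epsilon> * (pi / (2 * of_int n)))) =
    (-1) ^ k * cis (of_int \<epsilon> * (of_nat k * (pi / (2 * of_int n))))"
    by (simp add: distrib_left cis_mult[symmetric] Complex.DeMoivre[symmetric] mult.left_commute)
  then show ?thesis
    by (simp only: lens_gen_funpow a)
qed

text \<open>Two points of an interval of length \<open>a\<close> are at most \<open>a\<close> apart,
  and distance \<open>a\<close> forces them to be the endpoints.\<close>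

lemma multiple_in_interval_cases:
  fixes a x y :: real and j :: int
  assumes "a > 0" "x \<in> {0..a}" "y \<in> {0..a}" "y - x = of_int j * a"
  obtains "j = 0" "y = x" | "j = 1" "x = 0" "y = a" | "j = -1" "x = a" "y = 0"
proof -
  have "of_int j * a \<le> 1 * a" "-1 * a \<le> of_int j * a"
    using assms(2,3) by (auto simp flip: assms(4))
  then have "of_int j \<le> (1::real)" "-1 \<le> (of_int j::real)"
    using assms(1) by (simp_all only: mult_le_cancel_right_pos)
  then have "j = 0 \<or> j = 1 \<or> j = -1" by linarith
  then show thesis using that assms by auto
qed

section \<open>The gluing relation as the pullback of the orbit relation\<close>

lemma klein_glue_imp_lens_rel:
  assumes n: "n \<ge> 1" and e: "\<epsilon> \<in> {1, -1}" and "klein_glue n x y"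
  shows "(klein_map \<epsilon> x, klein_map \<epsilon> y) \<in> lens_rel (4 * n) (2 * n + \<epsilon>)"
proof -
  have "\<exists>k. klein_map \<epsilon> y = (lens_gen (4 * n) (2 * n + \<epsilon>) ^^ k) (klein_map \<epsilon> x)"
    using assms(3)
  proof cases
    case (1 \<phi>)
    \<comment> \<open>The total angle is pi and the exponent is even, so the second coordinate is
      multiplied by \<open>cis (of_int \<epsilon> * pi)\<close>, which is -1; the first is
      zero.\<close>
    have "real (nat (2 * n)) * (pi / (2 * of_int n)) = pi" "even (nat (2 * n))"
      using n by (auto simp: even_nat_iff)
    then have "klein_map \<epsilon> y = (lens_gen (4 * n) (2 * n + \<epsilon>) ^^ nat (2 * n)) (klein_map \<epsilon> x)"
      by (simp only: 1 klein_map_def prod.case lens_gen_klein_funpow[OF n e])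
         (simp add: cis_sign_mult[OF e])
    then show ?thesis ..
  next
    case (2 \<theta>)
    \<comment> \<open>The sign of the generator matches cos(pi - \<theta>) = -cos \<theta>, while
      the sine is unchanged.\<close>
    have "klein_map \<epsilon> y = (lens_gen (4 * n) (2 * n + \<epsilon>) ^^ 1) (klein_map \<epsilon> x)"
      by (simp only: 2 klein_map_def prod.case lens_gen_klein_funpow[OF n e]) simp
    then show ?thesis ..
  qed
  then show ?thesis
    using klein_map_in_S3 unfolding lens_rel_def by blast
qed

text \<open>The pullback of the orbit relation is an equivalence containing the gluing, hence
  contains the equivalence closure.\<close>

lemma klein_rel_imp_lens_rel:
  assumes n: "n \<ge> 1" and e: "\<epsilon> \<in> {1, -1}" and "(x, y) \<in> klein_rel n"
  shows "(klein_map \<epsilon> x, klein_map \<epsilon> y) \<in> lens_rel (4 * n) (2 * n + \<epsilon>)"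
proof -
  have eq: "equiv S3 (lens_rel (4 * n) (2 * n + \<epsilon>))"
    using n by (intro equiv_lens_rel) simp
  have "equivclp (klein_glue n) x y"
    using assms(3) by (simp add: klein_rel_def)
  then show ?thesis
  proof (induction rule: equivclp_induct)
    case base
    then show ?case
      using equiv_class_eq_iff[OF eq] klein_map_in_S3 by blast
  next
    case (step y z)
    from step(2) have "(klein_map \<epsilon> y, klein_map \<epsilon> z) \<in> lens_rel (4 * n) (2 * n + \<epsilon>)"
      using klein_glue_imp_lens_rel[OF n e] eq by (metis equivE symD)
    with step(3) show ?case
      using eq by (metis equivE transD)
  qed
qed

lemma lens_rel_imp_klein_rel:
  assumes n: "n \<ge> 1" and e: "\<epsilon> \<in> {1, -1}" and x: "x \<in> klein_rect n" and y: "y \<in> klein_rect n"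
    and rel: "(klein_map \<epsilon> x, klein_map \<epsilon> y) \<in> lens_rel (4 * n) (2 * n + \<epsilon>)"
  shows "(x, y) \<in> klein_rel n"
proof -
  define a where "a = pi / (2 * of_int n)"
  obtain \<phi> \<theta> \<phi>' \<theta>' where xy: "x = (\<phi>, \<theta>)" "y = (\<phi>', \<theta>')" by fastforce
  have a0: "a > 0" and pi_a: "pi = of_int (2 * n) * a"
    using n by (simp_all add: a_def)
  have rng: "\<phi> \<in> {0..a}" "\<phi>' \<in> {0..a}" "\<theta> \<in> {0..pi}" "\<theta>' \<in> {0..pi}"
    using x y by (auto simp: xy klein_rect_def a_def)
  obtain k where "klein_map \<epsilon> y = (lens_gen (4 * n) (2 * n + \<epsilon>) ^^ k) (klein_map \<epsilon> x)"
    using rel by (auto simp: lens_rel_def)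
  then have eqs: "of_real (sin \<theta>') * cis \<phi>' = cis (of_nat k * a) * (of_real (sin \<theta>) * cis \<phi>)"
    "of_real (cos \<theta>') * cis (of_int \<epsilon> * \<phi>') =
      (-1) ^ k * cis (of_int \<epsilon> * (of_nat k * a)) * (of_real (cos \<theta>) * cis (of_int \<epsilon> * \<phi>))"
    unfolding xy klein_map_def prod.case lens_gen_klein_funpow[OF n e] a_def[symmetric]
    by (simp_all only: prod.inject)
  have z1: "of_real (sin \<theta>') * cis \<phi>' = of_real (sin \<theta>) * cis (of_nat k * a + \<phi>)"
    unfolding eqs cis_mult[symmetric] by (simp only: mult_ac)
  have z2: "of_real (cos \<theta>') * cis (of_int \<epsilon> * \<phi>') =
      of_real ((-1) ^ k * cos \<theta>) * cis (of_int \<epsilon> * (of_nat k * a + \<phi>))"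
    unfolding eqs distrib_left cis_mult[symmetric]
    by (simp only: of_real_mult of_real_power of_real_minus of_real_1 mult_ac)
  have g1: "equivclp (klein_glue n) (t, 0) (t, pi)" if "t \<in> {0..a}" for t
    using that by (intro r_into_equivclp klein_glue.intros) (simp add: a_def)
  have g2: "equivclp (klein_glue n) (0, t) (a, pi - t)" if "t \<in> {0..pi}" for t
    unfolding a_def using that by (intro r_into_equivclp klein_glue.intros)
  note sym = equivclp_sym[of "klein_glue n"] and trans = equivclp_trans[of "klein_glue n"]
  have sin0: "sin \<theta> \<ge> 0" "sin \<theta>' \<ge> 0"
    using rng by (auto intro: sin_ge_zero)
  \<comment> \<open>Norms remove the phases, and the sine is nonnegative on [0, pi].\<close>
  have "norm (of_real (sin \<theta>') * cis \<phi>') = norm (of_real (sin \<theta>) * cis (of_nat k * a + \<phi>))"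
    by (simp only: z1)
  then have sin_eq: "sin \<theta>' = sin \<theta>"
    using sin0 by (simp add: norm_mult)
  have "equivclp (klein_glue n) x y"
  proof (cases "sin \<theta> = 0")
    case False
    then have "cis \<phi>' = cis (of_nat k * a + \<phi>)"
      using z1 sin_eq by simp
    then obtain m :: int where m: "\<phi>' = of_nat k * a + \<phi> + 2 * pi * m"
      unfolding cis_eq_cis_iff by blast
    \<comment> \<open>Since 2 pi = 4 n a, full turns change the multiple of \<open>a\<close> by 4 n
      m, which preserves parity.\<close>
    define j where "j = int k + 4 * n * m"
    have j: "\<phi>' - \<phi> = of_int j * a"
      using m by (simp add: j_def pi_a algebra_simps)
    have par: "even k \<longleftrightarrow> even j" by (simp add: j_def)
    \<comment> \<open>As \<epsilon> is an integer, a difference by full turns remains one after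
      scaling, so the phases cancel in \<open>z2\<close>.\<close>
    have "of_int \<epsilon> * \<phi>' = of_int \<epsilon> * (of_nat k * a + \<phi>) + 2 * pi * of_int (\<epsilon> * m)"
      by (simp add: m algebra_simps)
    then have "cis (of_int \<epsilon> * \<phi>') = cis (of_int \<epsilon> * (of_nat k * a + \<phi>))"
      unfolding cis_eq_cis_iff by blast
    with z2 have "complex_of_real (cos \<theta>') = of_real ((-1) ^ k * cos \<theta>)"
      by simp
    then have cos_eq: "cos \<theta>' = (-1) ^ k * cos \<theta>"
      by (simp only: of_real_eq_iff)
    have odd_case: "\<theta>' = pi - \<theta>" if "odd j"
      by (rule cos_inj_pi) (use cos_eq that par rng in auto)
    show ?thesis
      using a0 rng(1,2) j
    proof (cases rule: multiple_in_interval_cases)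
      case 1
      have "\<theta>' = \<theta>"
        by (rule cos_inj_pi) (use 1 cos_eq par rng in auto)
      with 1 show ?thesis by (simp add: xy)
    next
      case 2
      then show ?thesis using g2[of \<theta>] odd_case rng by (simp add: xy)
    next
      case 3
      then show ?thesis using sym[OF g2[of \<theta>']] odd_case rng by (simp add: xy)
    qed
  next
    \<comment> \<open>The first coordinate vanishes and \<theta> is 0 or pi, so \<open>z2\<close>
      fixes the angle only modulo pi = 2 n a.\<close>
    case True
    have ends: "t = 0 \<or> t = pi" if "t \<in> {0..pi}" "sin t = 0" for t
      using that sin_gt_zero[of t] by force
    have th: "\<theta> = 0 \<or> \<theta> = pi" "\<theta>' = 0 \<or> \<theta>' = pi"
      using ends rng True sin_eq by auto
    define b where "b = \<phi>' - (of_nat k * a + \<phi>)"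
    have "cis (of_int \<epsilon> * \<phi>') = cis (of_int \<epsilon> * (of_nat k * a + \<phi>)) \<or>
        cis (of_int \<epsilon> * \<phi>') = - cis (of_int \<epsilon> * (of_nat k * a + \<phi>))"
      using z2 th by (cases "even k") (auto simp: eq_neg_iff_add_eq_0 neg_eq_iff_add_eq_0)
    moreover have "cis (of_int \<epsilon> * \<phi>') = cis (of_int \<epsilon> * b) * cis (of_int \<epsilon> * (of_nat k * a + \<phi>))"
      by (simp add: cis_mult b_def algebra_simps)
    ultimately have "cis (of_int \<epsilon> * b) = 1 \<or> cis (of_int \<epsilon> * b) = -1"
      by (metis cis_neq_zero mult_cancel_right1 mult_cancel_right2 mult_minus_left mult_1 mult_cancel_right)
    then have "sin (of_int \<epsilon> * b) = 0"
      by (auto simp: complex_eq_iff)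
    then have "sin b = 0" using e by auto
    then obtain i :: int where i: "b = of_int i * pi"
      by (auto simp: sin_zero_iff_int2)
    have j: "\<phi>' - \<phi> = of_int (int k + 2 * n * i) * a"
      using i by (simp add: b_def pi_a algebra_simps)
    have base: "equivclp (klein_glue n) (t, s) (t, 0)" if "t \<in> {0..a}" "s = 0 \<or> s = pi" for t s
      using sym[OF g1] that by auto
    \<comment> \<open>The second gluing sends (0, 0) to (a, pi), and the first brings it back to (a,
      0).\<close>
    have "equivclp (klein_glue n) (0, 0) (a, 0)"
      by (rule trans[of _ "(a, pi)"]) (use g2[of 0] base[of a pi] a0 in simp_all)
    with a0 rng(1,2) j have "equivclp (klein_glue n) (\<phi>, 0) (\<phi>', 0)"
      by (cases rule: multiple_in_interval_cases) (auto intro: sym)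
    then show ?thesis
      using base[OF rng(1) th(1)] base[OF rng(2) th(2)] unfolding xy by (metis sym trans)
  qed
  then show ?thesis
    using x y by (simp add: klein_rel_def)
qed

theorem mainTheorem2:
  fixes n \<epsilon> :: int
  assumes "n \<ge> 1" and "\<epsilon> \<in> {1, -1}"
  shows "\<exists>f. (\<forall>x \<in> klein_rect n.
                f (klein_rel n `` {x}) = lens_rel (4 * n) (2 * n + \<epsilon>) `` {klein_map \<epsilon> x})
           \<and> embedding_map (klein_bottle n) (lens_space (4 * n) (2 * n + \<epsilon>)) f"
proof -
  let ?X = "top_of_set (klein_rect n)"
  let ?L = "lens_rel (4 * n) (2 * n + \<epsilon>)"
  let ?\<pi> = "\<lambda>z. ?L `` {z}"
  have p: "4 * n \<ge> 1" using assms by simp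
  note eqL = equiv_lens_rel[OF p, of "2 * n + \<epsilon>"]
  have cont: "continuous_map ?X (top_of_set S3) (klein_map \<epsilon>)"
    using klein_map_in_S3 by (auto intro: continuous_on_klein_map)
  have "compact (klein_rect n)"
    unfolding klein_rect_def by (intro compact_Times) auto
  \<comment> \<open>A continuous map from a compact space to a Hausdorff space is closed.\<close>
  then have closed: "closed_map ?X (top_of_set S3) (klein_map \<epsilon>)"
    using cont by (intro continuous_imp_closed_map)
      (simp_all add: compact_space_subtopology Hausdorff_space_subtopology)
  have contL: "continuous_map (top_of_set S3) (lens_space (4 * n) (2 * n + \<epsilon>)) ?\<pi>"
    unfolding lens_space_def using eqL
    by (intro quotient_imp_continuous_map quotient_map_class) simp
  have q: "quotient_map ?X (klein_bottle n) (\<lambda>x. klein_rel n `` {x})"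
    unfolding klein_bottle_def using equiv_klein_rel by (intro quotient_map_class) simp
  show ?thesis
  proof (rule embedding_map_from_quotient[OF q continuous_map_compose[OF cont contL]
        closed_map_compose[OF closed closed_map_lens_projection[OF p]]])
    fix x y assume "x \<in> topspace ?X" "y \<in> topspace ?X"
    then have "(x, y) \<in> klein_rel n \<longleftrightarrow> (klein_map \<epsilon> x, klein_map \<epsilon> y) \<in> ?L"
      using klein_rel_imp_lens_rel[OF assms, of x y] lens_rel_imp_klein_rel[OF assms, of x y]
      by auto
    with \<open>x \<in> topspace ?X\<close> \<open>y \<in> topspace ?X\<close>
    show "klein_rel n `` {x} = klein_rel n `` {y} \<longleftrightarrow>
        (?\<pi> \<circ> klein_map \<epsilon>) x = (?\<pi> \<circ> klein_map \<epsilon>) y"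
      by (simp add: eq_equiv_class_iff[OF equiv_klein_rel]
          eq_equiv_class_iff[OF eqL klein_map_in_S3 klein_map_in_S3])
  next
    fix f
    assume f: "embedding_map (klein_bottle n) (lens_space (4 * n) (2 * n + \<epsilon>)) f"
      and "\<And>x. x \<in> topspace ?X \<Longrightarrow> f (klein_rel n `` {x}) = (?\<pi> \<circ> klein_map \<epsilon>) x"
    then have "f (klein_rel n `` {x}) = ?\<pi> (klein_map \<epsilon> x)" if "x \<in> klein_rect n" for x
      using that by simp
    with f show ?thesis by blast
  qed
qed

end
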